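(* Let $(X,\mathcal{A})$ be a measurable space. Each intermediate ring of measurable functions, i.e. each ring $N(X,\mathcal{A})$ with $\mathcal{M}^*(X,\mathcal{A})\subseteq N(X,\mathcal{A})\subseteq\mathcal{M}(X,\mathcal{A})$, is a Gelfand ring.
   Context: A measurable space $(X,\mathcal{A})$ is a nonempty set $X$ with a $\sigma$-algebra $\mathcal{A}$ of subsets of $X$. $\mathcal{M}(X,\mathcal{A})$ is the commutative ring (pointwise operations) of all $\mathcal{A}$-measurable functions $X\to\mathbb{R}$, and $\mathcal{M}^*(X,\mathcal{A})$ is its subring of bounded functions; an intermediate ring is a subring of $\mathcal{M}(X,\mathcal{A})$ containing $\mathcal{M}^*(X,\mathcal{A})$. A commutative ring with unity is Gelfand if every (proper) prime ideal is contained in a unique maximal ideal. *)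

theory Defs
  imports "HOL-Analysis.Borel_Space" "HOL-Algebra.Subrings"
begin

text \<open>Functions on \<open>X\<close> are represented by extensional functions (equal to \<open>undefined\<close> outside
  \<open>X\<close>), so that equality in the ring is pointwise equality on \<open>X\<close>. The measure space
  \<open>sigma X \<A>\<close> only serves to carry the \<open>\<sigma>\<close>-algebra \<open>\<A>\<close>.\<close>

definition measurable_functions :: "'a set \<Rightarrow> 'a set set \<Rightarrow> ('a \<Rightarrow> real) ring" where
  "measurable_functions X \<A> =
    \<lparr>carrier = borel_measurable (sigma X \<A>) \<inter> extensional X,
     mult = (\<lambda>f g. \<lambda>x\<in>X. f x * g x),
     one = (\<lambda>x\<in>X. 1),
     zero = (\<lambda>x\<in>X. 0),
     add = (\<lambda>f g. \<lambda>x\<in>X. f x + g x)\<rparr>"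

definition bounded_measurable_functions :: "'a set \<Rightarrow> 'a set set \<Rightarrow> ('a \<Rightarrow> real) set" where
  "bounded_measurable_functions X \<A> =
    {f \<in> carrier (measurable_functions X \<A>). bounded (f ` X)}"

definition intermediate_ring :: "'a set \<Rightarrow> 'a set set \<Rightarrow> ('a \<Rightarrow> real) set \<Rightarrow> bool" where
  "intermediate_ring X \<A> N \<longleftrightarrow>
    subring N (measurable_functions X \<A>) \<and> bounded_measurable_functions X \<A> \<subseteq> N"

text \<open>Properness of prime and maximal ideals is part of \<^const>\<open>primeideal\<close> and
  \<^const>\<open>maximalideal\<close>.\<close>

definition gelfand_ring :: "('a, 'b) ring_scheme \<Rightarrow> bool" where
  "gelfand_ring R \<longleftrightarrow>
    cring R \<and> (\<forall>P. primeideal P R \<longrightarrow> (\<exists>!M. maximalideal M R \<and> P \<subseteq> M))"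

end

theory Submission
  imports Defs "HOL-Algebra.Ring_Divisibility"
begin

text \<open>Intermediate rings of measurable functions are exchange rings: if \<open>a + b = 1\<close>, then the
  indicator \<open>e\<close> of \<open>{a \<ge> 1/2}\<close> is a multiple of \<open>a\<close>, and \<open>1 - e\<close> is a multiple of \<open>b\<close>, both with
  bounded cofactors. If a prime \<open>P\<close> lay in two maximal ideals \<open>M \<noteq> M'\<close>, choose \<open>a \<in> M\<close>, \<open>b \<in> M'\<close>
  with \<open>a + b = 1\<close>. Then \<open>e \<in> M\<close> and \<open>1 - e \<in> M'\<close>, while \<open>e (1 - e) = 0\<close> puts one of the two into
  \<open>P\<close>, so \<open>1\<close> lies in \<open>M'\<close> or in \<open>M\<close>.\<close>

lemma (in ring) exists_maximalideal_superset:
  assumes "ideal I R" and "\<one> \<notin> I"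
  obtains M where "maximalideal M R" and "I \<subseteq> M"
proof -
  \<comment> \<open>Properness is expressed by 1 not lying in the ideal, a condition that passes at
    once to the union of a chain; this is what Zorn's lemma needs.\<close>
  define S where "S = {J. ideal J R \<and> I \<subseteq> J \<and> \<one> \<notin> J}"
  have "\<exists>M\<in>S. \<forall>J\<in>S. M \<subseteq> J \<longrightarrow> J = M"
  proof (rule subset_Zorn_nonempty)
    show "S \<noteq> {}"
      using assms by (auto simp: S_def)
    fix C assume "C \<noteq> {}" and chain: "subset.chain S C"
    then have "subset.chain {J. ideal J R} C"
      by (auto simp: S_def subset_chain_def)
    then have "ideal (\<Union>C) R"
      using chain_Union_is_ideal[of C] \<open>C \<noteq> {}\<close> by simp
    with chain \<open>C \<noteq> {}\<close> show "\<Union>C \<in> S"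
      by (auto simp: S_def subset_chain_def)
  qed
  then obtain M where M: "ideal M R" "I \<subseteq> M" "\<one> \<notin> M"
    and max: "\<And>J. J \<in> S \<Longrightarrow> M \<subseteq> J \<Longrightarrow> J = M"
    by (auto simp: S_def)
  have "maximalideal M R"
  proof (rule maximalidealI)
    fix J assume J: "ideal J R" "M \<subseteq> J" "J \<subseteq> carrier R"
    show "J = M \<or> J = carrier R"
    proof (cases "\<one> \<in> J")
      case True
      then show ?thesis
        using ideal.one_imp_carrier[OF J(1)] by simp
    next
      case False
      then show ?thesis
        using J M max[of J] by (auto simp: S_def)
    qed
  qed (use M in auto)
  then show thesis
    using M(2) that by blast
qed

text \<open>By maximality, the ideal generated by two distinct maximal ideals is the whole ring, and
  it coincides with their sum.\<close>

lemma (in cring) maximalideals_sum_one: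
  assumes M: "maximalideal M R" and M': "maximalideal M' R" and "M \<noteq> M'"
  obtains a b where "a \<in> M" "b \<in> M'" "a \<oplus> b = \<one>"
proof -
  interpret M: maximalideal M R by fact
  interpret M': maximalideal M' R by fact
  have carrier: "M \<union> M' \<subseteq> carrier R"
    using M.a_subset M'.a_subset by blast
  note sum = genideal_ideal[OF carrier]
  have "M \<subseteq> Idl (M \<union> M')" "M' \<subseteq> Idl (M \<union> M')"
    using genideal_self[OF carrier] by auto
  moreover have "Idl (M \<union> M') \<subseteq> carrier R"
    using additive_subgroup.a_subset[OF ideal.axioms(1)[OF sum]] .
  \<comment> \<open>Otherwise maximality of \<open>M'\<close> would leave only \<open>M = M'\<close>
    or \<open>M = carrier R\<close>, and \<open>M\<close> is proper.\<close>
  moreover have "\<not> M' \<subseteq> M"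
    using M'.I_maximal[OF M.is_ideal] M.I_notcarr M.a_subset \<open>M \<noteq> M'\<close> by auto
  ultimately have "Idl (M \<union> M') = carrier R"
    using M.I_maximal[OF sum] by auto
  then have "\<one> \<in> M <+> M'"
    by (simp add: union_genideal[OF M.is_ideal M'.is_ideal])
  then show thesis
    using that by (auto simp: set_add_def')
qed

text \<open>Elements with sum 1 and product 0 are complementary idempotents, so the hypothesis
  refines each decomposition of 1 to an idempotent one. This separates the algebraic half of the
  argument from the functions.\<close>

lemma (in cring) exchange_imp_gelfand_ring:
  assumes exchange: "\<And>a b. \<lbrakk>a \<in> carrier R; b \<in> carrier R; a \<oplus> b = \<one>\<rbrakk> \<Longrightarrow>
    \<exists>u\<in>carrier R. \<exists>v\<in>carrier R. (u \<otimes> a) \<oplus> (v \<otimes> b) = \<one> \<and> (u \<otimes> a) \<otimes> (v \<otimes> b) = \<zero>"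
  shows "gelfand_ring R"
  unfolding gelfand_ring_def
proof (intro conjI allI impI ex_ex1I)
  show "cring R" ..
  fix P assume "primeideal P R"
  then interpret P: primeideal P R .
  have "\<one> \<notin> P"
    using P.I_notcarr P.one_imp_carrier by metis
  then show "\<exists>M. maximalideal M R \<and> P \<subseteq> M"
    using exists_maximalideal_superset[OF P.is_ideal] by metis
  fix M M' assume *: "maximalideal M R \<and> P \<subseteq> M" "maximalideal M' R \<and> P \<subseteq> M'"
  interpret M: maximalideal M R using * by blast
  interpret M': maximalideal M' R using * by blast
  show "M = M'"
  proof (rule ccontr)
    assume "M \<noteq> M'"
    then obtain a b where ab: "a \<in> M" "b \<in> M'" "a \<oplus> b = \<one>"
      using * maximalideals_sum_one by metis
    then obtain u v where uv: "u \<in> carrier R" "v \<in> carrier R"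
      and one: "(u \<otimes> a) \<oplus> (v \<otimes> b) = \<one>" and zero: "(u \<otimes> a) \<otimes> (v \<otimes> b) = \<zero>"
      using exchange[of a b] M.a_Hcarr M'.a_Hcarr by blast
    have mem: "u \<otimes> a \<in> M" "v \<otimes> b \<in> M'"
      using ab uv M.I_l_closed M'.I_l_closed by auto
    have "u \<otimes> a \<in> P \<or> v \<otimes> b \<in> P"
      using P.I_prime zero ab uv M.a_Hcarr M'.a_Hcarr by simp
    \<comment> \<open>As \<open>P\<close> lies in both \<open>M\<close> and \<open>M'\<close>,
      having \<open>u \<otimes> a\<close> in \<open>P\<close> puts both summands of 1 into
      \<open>M'\<close>; in the other case both lie in \<open>M\<close>.\<close>
    then have "\<one> \<in> M' \<or> \<one> \<in> M"
      using mem * one M.a_closed M'.a_closed by (metis subsetD)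
    then show False
      using M.I_notcarr M'.I_notcarr M.one_imp_carrier M'.one_imp_carrier by metis
  qed
qed

context
  fixes X :: "'a set" and \<A> :: "'a set set"
  assumes sigma: "sigma_algebra X \<A>"
begin

lemma space_sigma: "space (sigma X \<A>) = X"
proof (rule space_measure_of)
  interpret sigma_algebra X \<A> by (rule sigma)
  show "\<A> \<subseteq> Pow X"
    by (rule space_closed)
qed

lemma restrict_measurable_functions:
  assumes "f \<in> borel_measurable (sigma X \<A>)"
  shows "restrict f X \<in> carrier (measurable_functions X \<A>)"
  using assms measurable_cong[of "sigma X \<A>" f "restrict f X" borel]
  by (simp add: measurable_functions_def space_sigma)

lemma measurable_functions_measurable:
  "f \<in> carrier (measurable_functions X \<A>) \<Longrightarrow> f \<in> borel_measurable (sigma X \<A>)"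
  by (simp add: measurable_functions_def)

lemma measurable_functions_eqI:
  assumes "f \<in> carrier (measurable_functions X \<A>)" "g \<in> carrier (measurable_functions X \<A>)"
    and "\<And>x. x \<in> X \<Longrightarrow> f x = g x"
  shows "f = g"
  using assms by (auto simp: measurable_functions_def intro: extensionalityI)

lemma cring_measurable_functions: "cring (measurable_functions X \<A>)" (is "cring ?R")
proof -
  have add: "add ?R f g = (\<lambda>x\<in>X. f x + g x)" and mult: "mult ?R f g = (\<lambda>x\<in>X. f x * g x)" for f g
    by (simp_all add: measurable_functions_def)
  have zero: "zero ?R = (\<lambda>x\<in>X. 0)" and one: "one ?R = (\<lambda>x\<in>X. 1)"
    by (simp_all add: measurable_functions_def)
  have add_closed: "add ?R f g \<in> carrier ?R" and mult_closed: "mult ?R f g \<in> carrier ?R"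
    if "f \<in> carrier ?R" "g \<in> carrier ?R" for f g
    using that[THEN measurable_functions_measurable] unfolding add mult
    by (auto intro!: restrict_measurable_functions)
  have const_closed: "zero ?R \<in> carrier ?R" "one ?R \<in> carrier ?R"
    by (auto simp: zero one intro!: restrict_measurable_functions)
  note closed = add_closed mult_closed const_closed
  have val: "add ?R f g x = f x + g x" "mult ?R f g x = f x * g x" "zero ?R x = 0" "one ?R x = 1"
    if "x \<in> X" for f g x
    using that by (simp_all add: add mult zero one)
  have minus: "(\<lambda>x\<in>X. - f x) \<in> carrier ?R" "add ?R (\<lambda>x\<in>X. - f x) f = zero ?R"
    if "f \<in> carrier ?R" for f
    using that[THEN measurable_functions_measurable]
    by (auto simp: add zero intro!: restrict_measurable_functions)
  show ?thesis
  proof (intro cringI abelian_groupI comm_monoidI)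
    show "\<exists>g\<in>carrier ?R. add ?R g f = zero ?R" if "f \<in> carrier ?R" for f
      using minus[OF that] by blast
  \<comment> \<open>Each remaining law between extensional functions reduces to real arithmetic at
    the points of \<open>X\<close>.\<close>
  qed (assumption | rule closed | rule measurable_functions_eqI | simp add: val algebra_simps)+
qed

text \<open>Although \<open>a\<close> and \<open>b\<close> may be unbounded, the cofactors are
  reciprocals taken only where the denominator is at least 1/2. They are thus bounded by 2 and lie
  in \<open>N\<close>, which contains all bounded measurable functions.\<close>

lemma intermediate_ring_exchange:
  assumes N: "intermediate_ring X \<A> N"
    and "a \<in> N" "b \<in> N" and sum: "\<And>x. x \<in> X \<Longrightarrow> a x + b x = 1"
  shows "\<exists>u\<in>N. \<exists>v\<in>N. \<forall>x\<in>X. u x * a x + v x * b x = 1 \<and> (u x * a x) * (v x * b x) = 0"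
proof -
  \<comment> \<open>The threshold 1/2 excludes division by zero in both branches: where
    \<open>a x < 1/2\<close>, the sum condition forces \<open>b x > 1/2\<close>.\<close>
  define u where "u = (\<lambda>x\<in>X. if a x \<ge> 1/2 then 1 / a x else 0)"
  define v where "v = (\<lambda>x\<in>X. if a x \<ge> 1/2 then 0 else 1 / b x)"
  have "N \<subseteq> carrier (measurable_functions X \<A>)"
    using N subringE(1) by (auto simp: intermediate_ring_def)
  then have [measurable]: "a \<in> borel_measurable (sigma X \<A>)" "b \<in> borel_measurable (sigma X \<A>)"
    using \<open>a \<in> N\<close> \<open>b \<in> N\<close> measurable_functions_measurable by auto
  have b: "b x > 1/2" if "x \<in> X" "\<not> a x \<ge> 1/2" for x
    using sum[OF that(1)] that(2) by linarith
  have "u \<in> carrier (measurable_functions X \<A>)" "v \<in> carrier (measurable_functions X \<A>)"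
    unfolding u_def v_def by (rule restrict_measurable_functions; measurable)+
  moreover have "\<bar>u x\<bar> \<le> 2" "\<bar>v x\<bar> \<le> 2" if "x \<in> X" for x
    using that b[of x] by (auto simp: u_def v_def field_simps)
  then have "bounded (u ` X)" "bounded (v ` X)"
    by (auto simp: bounded_iff intro!: exI[of _ 2])
  ultimately have "u \<in> N" "v \<in> N"
    using N by (auto simp: intermediate_ring_def bounded_measurable_functions_def)
  moreover have "u x * a x + v x * b x = 1 \<and> (u x * a x) * (v x * b x) = 0" if "x \<in> X" for x
    using that b[of x] by (cases "a x \<ge> 1/2") (auto simp: u_def v_def)
  ultimately show ?thesis
    by blast
qed

end

theorem corollary2p10:
  fixes X :: "'a set" and \<A> :: "'a set set" and N :: "('a \<Rightarrow> real) set"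
  assumes "sigma_algebra X \<A>"
    and "X \<noteq> {}"
    and "intermediate_ring X \<A> N"
  shows "gelfand_ring ((measurable_functions X \<A>)\<lparr>carrier := N\<rparr>)"
proof -
  let ?R = "measurable_functions X \<A>"
  interpret R: cring ?R
    using assms(1) by (rule cring_measurable_functions)
  \<comment> \<open>The prime and maximal ideals in question are those of \<open>N\<close>, so the
    algebraic criterion is applied to \<open>N\<close> as a ring of its own, with cofactors from
    \<open>N\<close>.\<close>
  have "subcring N ?R"
    using assms(3) R.subcringI' by (simp add: intermediate_ring_def)
  then interpret N: cring "?R\<lparr>carrier := N\<rparr>"
    using R.subcring_iff assms(3) by (simp add: intermediate_ring_def subringE(1))
  show ?thesis
  proof (rule N.exchange_imp_gelfand_ring; simp)
    fix a b assume ab: "a \<in> N" "b \<in> N" and sum: "a \<oplus>\<^bsub>?R\<^esub> b = \<one>\<^bsub>?R\<^esub>"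
    have "a x + b x = 1" if "x \<in> X" for x
      using fun_cong[OF sum, of x] that by (simp add: measurable_functions_def)
    from intermediate_ring_exchange[OF assms(1,3) ab this]
    obtain u v where "u \<in> N" "v \<in> N"
      and "\<And>x. x \<in> X \<Longrightarrow> u x * a x + v x * b x = 1 \<and> (u x * a x) * (v x * b x) = 0"
      by blast
    then show "\<exists>u\<in>N. \<exists>v\<in>N. (u \<otimes>\<^bsub>?R\<^esub> a) \<oplus>\<^bsub>?R\<^esub> (v \<otimes>\<^bsub>?R\<^esub> b) = \<one>\<^bsub>?R\<^esub> \<and>
        (u \<otimes>\<^bsub>?R\<^esub> a) \<otimes>\<^bsub>?R\<^esub> (v \<otimes>\<^bsub>?R\<^esub> b) = \<zero>\<^bsub>?R\<^esub>"
      \<comment> \<open>Outside \<open>X\<close> both sides are \<open>undefined\<close>, so the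
        pointwise identities on \<open>X\<close> give equalities in the ring.\<close>
      by (intro bexI[of _ u] bexI[of _ v]) (auto simp: measurable_functions_def fun_eq_iff)
  qed
qed

end
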